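(* Let $n\ge 3$, let $\gamma,\xi_0,\xi_1>0$ and $\theta_Y, C\in\mathbb{R}$ be constants, and let $\vec{x}_i(t)=(x_i^{(1)}(t),x_i^{(2)}(t))^\top\in\mathbb{R}^2$, $1\le i\le n$, be differentiable functions of $t$ in an interval, with $x_1^{(2)}(t)=x_n^{(2)}(t)=0$, $x_n^{(1)}(t)<x_1^{(1)}(t)$, and $\vec{x}_{i+1}(t)\ne\vec{x}_i(t)$ for $1\le i\le n-1$; let $\lambda(t)\in\mathbb{R}$. Suppose that for every $t$ the vector $\dot X=(\dot{\vec{x}}_1^\top,\dots,\dot{\vec{x}}_n^\top,\lambda)^\top\in\mathbb{R}^{2n+1}$ is the solution of the discrete wetting system $$\begin{cases}\dfrac{\partial\tilde\Phi_h}{\partial\dot{\vec{x}}_i}+\lambda\dfrac{\partial(\tilde S_h)_t}{\partial\dot{\vec{x}}_i}=-\dfrac{\partial\tilde{\mathcal{E}}_h}{\partial\vec{x}_i},\quad 2\le i\le n-1,\\[1ex] \dfrac{\partial\tilde\Phi_h}{\partial\dot{x}_j^{(1)}}+\lambda\dfrac{\partial(\tilde S_h)_t}{\partial\dot{x}_j^{(1)}}=-\dfrac{\partial\tilde{\mathcal{E}}_h}{\partial x_j^{(1)}},\quad j\in\{1,n\},\\[1ex] (\tilde S_h)_t=0,\qquad \dot{x}_1^{(2)}=0,\qquad \dot{x}_n^{(2)}=0,\end{cases}$$ where $\tilde{\mathcal{E}}_h$, $\tilde\Phi_h$ and $(\tilde S_h)_t$ are defined in the context. Then $$\frac{\mathrm{d}\tilde{\mathcal{E}}_h}{\mathrm{d}t}=-2\tilde\Phi_h\le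 0,$$ and the equality $\frac{\mathrm{d}\tilde{\mathcal{E}}_h}{\mathrm{d}t}=0$ holds if and only if $\dot{\vec{x}}_i=0$ for all $1\le i\le n$.
   Context: The open polygonal curve $\tilde\Gamma_h(t)=\bigcup_{i=1}^{n-1}\tilde\Gamma_i(t)$, where $\tilde\Gamma_i(t)$ is the segment from $\vec{x}_i(t)$ to $\vec{x}_{i+1}(t)$, has right endpoint $\vec{x}_1$ and left endpoint $\vec{x}_n$ on the horizontal line $x^{(2)}=0$ (nodes ordered counterclockwise). A dot denotes the time derivative. Discrete energy ($\gamma$ is the surface energy density, $\theta_Y$ is Young's angle, $C$ is a constant): $$\tilde{\mathcal{E}}_h=\gamma\Big\{\sum_{i=1}^{n-1}|\vec{x}_{i+1}-\vec{x}_i|-[x_1^{(1)}-x_n^{(1)}]\cos\theta_Y\Big\}+C.$$ Discrete velocity: at the point $(1-\mu)\vec{x}_i+\mu\vec{x}_{i+1}$ of $\tilde\Gamma_i$, $\mu\in[0,1]$, set $\vec{v}_h=(1-\mu)\dot{\vec{x}}_i+\mu\dot{\vec{x}}_{i+1}$. Discrete dissipation function ($\xi_0,\xi_1$ are friction coefficients, $s$ is arc length): $$\tilde\Phi_h=\frac{\xi_0}{2}\sum_{i=1}^{n-1}\int_{\tilde\Gamma_i}|(1-\mu)\dot{\vec{x}}_i+\mu\dot{\vec{x}}_{i+1}|^2\,\mathrm{d}s+\frac{\xi_1}{2}\big[\dot{x}_1^{(1)}\big]^2+\frac{\xi_1}{2}\big[\dot{x}_n^{(1)}\big]^2,\qquad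 \mathrm{d}s=|\vec{x}_{i+1}-\vec{x}_i|\,\mathrm{d}\mu .$$ The endpoint velocities are horizontal, i.e. $\dot{x}_1^{(2)}=\dot{x}_n^{(2)}=0$. Rate of change of the area $\tilde S_h$ enclosed by $\tilde\Gamma_h$ and the horizontal line: with $P=\begin{pmatrix}0&1\\-1&0\end{pmatrix}$ and $\vec{n}_i=P(\vec{x}_{i+1}-\vec{x}_i)/|\vec{x}_{i+1}-\vec{x}_i|$, $$(\tilde S_h)_t=\frac{\mathrm{d}\tilde S_h}{\mathrm{d}t}=\sum_{i=1}^{n-1}\int_{\tilde\Gamma_i}\vec{v}_h\cdot\vec{n}_i\,\mathrm{d}s,$$ a linear function of the velocities, with $\frac{\partial(\tilde S_h)_t}{\partial\dot{\vec{x}}_i}=\frac{P}{2}(\vec{x}_{i+1}-\vec{x}_{i-1})$ for $2\le i\le n-1$, $\frac{\partial(\tilde S_h)_t}{\partial\dot{x}_1^{(1)}}=\frac{x_2^{(2)}}{2}$, $\frac{\partial(\tilde S_h)_t}{\partial\dot{x}_n^{(1)}}=-\frac{x_{n-1}^{(2)}}{2}$. *)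

theory Defs
  imports "HOL-Analysis.Analysis"
begin

text \<open>
  Nodal data (positions \<open>X\<close>, velocities \<open>V\<close>) of a polygonal curve with nodes \<open>1, \<dots>, n\<close>
  are functions \<open>nat \<Rightarrow> real^2\<close>; only the values at the indices \<open>1, \<dots>, n\<close> are used.
\<close>

definition discrete_energy ::
  "nat \<Rightarrow> real \<Rightarrow> real \<Rightarrow> real \<Rightarrow> (nat \<Rightarrow> real^2) \<Rightarrow> real" where
  "discrete_energy n \<gamma> \<theta>\<^sub>Y C X =
     \<gamma> * ((\<Sum>i=1..n-1. norm (X (i+1) - X i)) - (X 1 $ 1 - X n $ 1) * cos \<theta>\<^sub>Y) + C"

text \<open>
  Arc length integral over the segment from \<open>X i\<close> to \<open>X (i+1)\<close> of a function given in the
  parameter \<open>\<mu> \<in> [0,1]\<close> of the point \<open>(1-\<mu>) X i + \<mu> X (i+1)\<close>, so \<open>ds = |X (i+1) - X i| d\<mu>\<close>.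
\<close>

definition segment_integral :: "(nat \<Rightarrow> real^2) \<Rightarrow> nat \<Rightarrow> (real \<Rightarrow> real) \<Rightarrow> real" where
  "segment_integral X i f = integral {0..1} (\<lambda>\<mu>. f \<mu> * norm (X (i+1) - X i))"

definition discrete_velocity :: "(nat \<Rightarrow> real^2) \<Rightarrow> nat \<Rightarrow> real \<Rightarrow> real^2" where
  "discrete_velocity V i \<mu> = (1 - \<mu>) *\<^sub>R V i + \<mu> *\<^sub>R V (i+1)"

definition discrete_dissipation ::
  "nat \<Rightarrow> real \<Rightarrow> real \<Rightarrow> (nat \<Rightarrow> real^2) \<Rightarrow> (nat \<Rightarrow> real^2) \<Rightarrow> real" where
  "discrete_dissipation n \<xi>\<^sub>0 \<xi>\<^sub>1 X V =
     \<xi>\<^sub>0 / 2 * (\<Sum>i=1..n-1. segment_integral X i (\<lambda>\<mu>. (norm (discrete_velocity V i \<mu>))\<^sup>2))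
     + \<xi>\<^sub>1 / 2 * (V 1 $ 1)\<^sup>2 + \<xi>\<^sub>1 / 2 * (V n $ 1)\<^sup>2"

definition P_mat :: "real^2^2" where
  "P_mat = vector [vector [0, 1], vector [-1, 0]]"

definition unit_normal :: "(nat \<Rightarrow> real^2) \<Rightarrow> nat \<Rightarrow> real^2" where
  "unit_normal X i = (1 / norm (X (i+1) - X i)) *\<^sub>R (P_mat *v (X (i+1) - X i))"

definition area_rate :: "nat \<Rightarrow> (nat \<Rightarrow> real^2) \<Rightarrow> (nat \<Rightarrow> real^2) \<Rightarrow> real" where
  "area_rate n X V =
     (\<Sum>i=1..n-1. segment_integral X i (\<lambda>\<mu>. discrete_velocity V i \<mu> \<bullet> unit_normal X i))"

text \<open>
  Partial derivative of \<open>F\<close> at \<open>Y\<close> with respect to the \<open>k\<close>-th coordinate of the \<open>i\<close>-th node, and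
  the vector of the two partial derivatives with respect to the \<open>i\<close>-th node.  The library's
  \<open>deriv\<close> is meaningful only where the derivative exists: this is the case for the dissipation and
  the area rate as functions of \<open>V\<close>, and for the energy at positions with
  \<open>X (i+1) \<noteq> X i\<close> for \<open>1 \<le> i \<le> n-1\<close>.
\<close>

definition node_partial ::
  "((nat \<Rightarrow> real^2) \<Rightarrow> real) \<Rightarrow> (nat \<Rightarrow> real^2) \<Rightarrow> nat \<Rightarrow> 2 \<Rightarrow> real" where
  "node_partial F Y i k = deriv (\<lambda>s. F (Y(i := Y i + s *\<^sub>R axis k 1))) 0"

definition node_grad ::
  "((nat \<Rightarrow> real^2) \<Rightarrow> real) \<Rightarrow> (nat \<Rightarrow> real^2) \<Rightarrow> nat \<Rightarrow> real^2" where
  "node_grad F Y i = (\<chi> k. node_partial F Y i k)"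

text \<open>
  The discrete wetting system at one instant for the unknowns \<open>V\<close> and \<open>l\<close> at positions \<open>X\<close>.
  The energy is differentiated in the positions, the dissipation and the area rate in the
  velocities.
\<close>

definition wetting_system ::
  "nat \<Rightarrow> real \<Rightarrow> real \<Rightarrow> real \<Rightarrow> real \<Rightarrow> real \<Rightarrow>
     (nat \<Rightarrow> real^2) \<Rightarrow> (nat \<Rightarrow> real^2) \<Rightarrow> real \<Rightarrow> bool" where
  "wetting_system n \<gamma> \<xi>\<^sub>0 \<xi>\<^sub>1 \<theta>\<^sub>Y C X V l \<longleftrightarrow>
     (\<forall>i\<in>{2..n-1}.
        node_grad (discrete_dissipation n \<xi>\<^sub>0 \<xi>\<^sub>1 X) V i + l *\<^sub>R node_grad (area_rate n X) V i
          = - node_grad (discrete_energy n \<gamma> \<theta>\<^sub>Y C) X i) \<and>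
     (\<forall>j\<in>{1, n}.
        node_partial (discrete_dissipation n \<xi>\<^sub>0 \<xi>\<^sub>1 X) V j 1 + l * node_partial (area_rate n X) V j 1
          = - node_partial (discrete_energy n \<gamma> \<theta>\<^sub>Y C) X j 1) \<and>
     area_rate n X V = 0 \<and> V 1 $ 2 = 0 \<and> V n $ 2 = 0"

end

theory Submission
  imports Defs
begin

text \<open>
  Pair the force balance at each node with the velocity of that node and sum. The energy forces
  give the time derivative of the energy by the chain rule. By Euler's identity for homogeneous
  functions the dissipation, quadratic in the velocities, contributes twice its value, and the area
  rate, linear in the velocities, contributes the multiplier times the area rate, which vanishes.
  At the two end nodes the missing vertical equation is harmless as the vertical velocity is zero.
\<close>

section \<open>Differentiating functions of finitely many nodes\<close>

text \<open>
  The assumed form of \<open>F\<close>, a sum of edge terms and a term for the two end nodes, reduces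
  differentiability on the infinite product to differentiability on pairs.
\<close>

lemma nodal_chain_rule:
  fixes F :: "(nat \<Rightarrow> real^2) \<Rightarrow> real" and x :: "nat \<Rightarrow> real \<Rightarrow> real^2"
  assumes F: "\<And>Z. F Z = (\<Sum>i=1..n-1. f i (Z i, Z (i+1))) + g (Z 1, Z n)" and "n \<ge> 1"
    and f: "\<And>i. i \<in> {1..n-1} \<Longrightarrow> f i differentiable (at (x i t, x (i+1) t))"
    and g: "g differentiable (at (x 1 t, x n t))"
    and x: "\<And>i. i \<in> {1..n} \<Longrightarrow> (x i has_vector_derivative v i) (at t within T)"
  shows "((\<lambda>s. F (\<lambda>i. x i s)) has_real_derivative
          (\<Sum>j=1..n. v j \<bullet> node_grad F (\<lambda>i. x i t) j)) (at t within T)"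
proof -
  define f' where "f' i = frechet_derivative (f i) (at (x i t, x (i+1) t))" for i
  define g' where "g' = frechet_derivative g (at (x 1 t, x n t))"
  have f': "(f i has_derivative f' i) (at (x i t, x (i+1) t))" if "i \<in> {1..n-1}" for i
    using f[OF that] unfolding f'_def by (simp add: frechet_derivative_works)
  have g': "(g has_derivative g') (at (x 1 t, x n t))"
    using g unfolding g'_def by (simp add: frechet_derivative_works)
  \<comment> \<open>\<open>D\<close> is the candidate differential of \<open>F\<close>, as a
    function of an arbitrary field \<open>w\<close> of nodal velocities.\<close>
  define D where "D w = (\<Sum>i=1..n-1. f' i (w i, w (i+1))) + g' (w 1, w n)" for w :: "nat \<Rightarrow> real^2"
  \<comment> \<open>Stated for any motion \<open>y\<close> through the configuration
    \<open>x i t\<close>, because it serves twice: for the given motion, and for the coordinate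
    lines that define \<open>node_partial\<close>.\<close>
  have chain: "((\<lambda>s. F (\<lambda>i. y i s)) has_real_derivative D w) (at r within R)"
    if y: "\<And>i. i \<in> {1..n} \<Longrightarrow> (y i has_vector_derivative w i) (at r within R)"
      and yx: "\<And>i. y i r = x i t" for y w r R
  proof -
    have pair: "((\<lambda>s. h (y i s, y j s)) has_vector_derivative h' (w i, w j)) (at r within R)"
      if "i \<in> {1..n}" "j \<in> {1..n}" and h: "(h has_derivative h') (at (x i t, x j t))"
      for i j and h h' :: "(real^2) \<times> (real^2) \<Rightarrow> real"
    proof -
      have "((\<lambda>s. (y i s, y j s)) has_vector_derivative (w i, w j)) (at r within R)"
        using y that(1,2) by (intro has_vector_derivative_Pair)
      then show ?thesis
        using vector_derivative_diff_chain_within[of "\<lambda>s. (y i s, y j s)" "(w i, w j)" r R h h'] h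
        by (simp add: yx o_def has_derivative_at_withinI)
    qed
    show ?thesis
      unfolding F D_def has_real_derivative_iff_has_vector_derivative
      using \<open>n \<ge> 1\<close>
      by (intro has_vector_derivative_add has_vector_derivative_sum pair f' g') auto
  qed
  \<comment> \<open>\<open>D\<close> sees only the nodes \<open>1..n\<close>, so its values on
    finitely many coordinate fields determine it.\<close>
  have lin: "D w = (\<Sum>j=1..n. \<Sum>k\<in>UNIV. w j $ k * D ((\<lambda>i. 0)(j := axis k 1)))" for w
  proof -
    \<comment> \<open>Both components of a pair are expanded over all nodes with the same
      coefficients, so that linearity of \<open>h\<close> on the product space applies directly,
      also when \<open>a = b\<close>.\<close>
    have expand: "h (w a, w b) = (\<Sum>j=1..n. \<Sum>k\<in>UNIV. w j $ k *
        h (((\<lambda>i. 0)(j := axis k 1)) a, ((\<lambda>i. 0)(j := axis k 1)) b))"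
      if h: "linear h" and ab: "a \<in> {1..n}" "b \<in> {1..n}"
      for a b and h :: "(real^2) \<times> (real^2) \<Rightarrow> real"
    proof -
      have w: "w a = (\<Sum>j=1..n. \<Sum>k\<in>UNIV. w j $ k *\<^sub>R ((\<lambda>i. 0)(j := axis k 1)) a)"
        if "a \<in> {1..n}" for a
      proof -
        have "(\<Sum>j=1..n. \<Sum>k\<in>UNIV. w j $ k *\<^sub>R ((\<lambda>i. 0)(j := axis k 1)) a)
            = (\<Sum>j=1..n. if j = a then w a else 0)"
          using basis_expansion[of "w a"]
          by (intro sum.cong) (auto simp: scalar_mult_eq_scaleR)
        then show ?thesis using that by simp
      qed
      have "h (w a, w b) = h (\<Sum>j=1..n. \<Sum>k\<in>UNIV. w j $ k *\<^sub>R
          (((\<lambda>i. 0)(j := axis k 1)) a, ((\<lambda>i. 0)(j := axis k 1)) b))"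
        by (subst w[OF ab(1)], subst w[OF ab(2)]) (simp only: sum_prod scaleR_Pair)
      also have "\<dots> = (\<Sum>j=1..n. \<Sum>k\<in>UNIV. w j $ k *
          h (((\<lambda>i. 0)(j := axis k 1)) a, ((\<lambda>i. 0)(j := axis k 1)) b))"
        by (simp only: linear_sum[OF h] linear_scale[OF h] real_scaleR_def)
      finally show ?thesis .
    qed
    have "(\<Sum>i=1..n-1. f' i (w i, w (i+1))) =
        (\<Sum>i=1..n-1. \<Sum>j=1..n. \<Sum>k\<in>UNIV. w j $ k *
          f' i (((\<lambda>i. 0)(j := axis k 1)) i, ((\<lambda>i. 0)(j := axis k 1)) (i+1)))"
      by (intro sum.cong refl expand has_derivative_linear[OF f']) auto
    also have "\<dots> = (\<Sum>j=1..n. \<Sum>k\<in>UNIV. w j $ k * (\<Sum>i=1..n-1.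
          f' i (((\<lambda>i. 0)(j := axis k 1)) i, ((\<lambda>i. 0)(j := axis k 1)) (i+1))))"
      by (subst sum.swap, intro sum.cong refl, subst sum.swap) (simp only: sum_distrib_left)
    finally show ?thesis
      unfolding D_def using \<open>n \<ge> 1\<close>
      by (simp only: expand[OF has_derivative_linear[OF g']] distrib_left sum.distrib
          atLeastAtMost_iff order_refl)
  qed
  \<comment> \<open>Coordinate lines are moved through parameter value 0. The chain rule shows that
    the derivative exists there, so \<open>deriv\<close> has its intended value.\<close>
  have partial: "node_partial F (\<lambda>i. x i t) j k = D ((\<lambda>i. 0)(j := axis k 1))" for j k
  proof -
    let ?y = "\<lambda>i s. ((\<lambda>i. x i t)(j := x j t + s *\<^sub>R axis k 1)) i"
    have "((\<lambda>s. F (\<lambda>i. ?y i s)) has_real_derivative D ((\<lambda>i. 0)(j := axis k 1))) (at 0)"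
    proof (rule chain)
      show "(?y i has_vector_derivative ((\<lambda>i. 0)(j := axis k 1)) i) (at 0)" for i
        by (cases "i = j") (auto simp: has_vector_derivative_def intro!: derivative_eq_intros)
    qed simp
    then show ?thesis
      unfolding node_partial_def by (rule DERIV_imp_deriv)
  qed
  have "D v = (\<Sum>j=1..n. v j \<bullet> node_grad F (\<lambda>i. x i t) j)"
    by (subst lin) (simp add: node_grad_def inner_vec_def partial)
  then show ?thesis
    using chain[of x v t T] x by simp
qed

text \<open>The map \<open>s \<mapsto> F (s V)\<close> is differentiated at \<open>s = 1\<close>
  twice, by the nodal chain rule and as \<open>s ^ d * F V\<close>; derivatives are unique.\<close>

lemma euler_homogeneous_nodal:
  fixes F :: "(nat \<Rightarrow> real^2) \<Rightarrow> real"
  assumes F: "\<And>Z. F Z = (\<Sum>i=1..n-1. f i (Z i, Z (i+1))) + g (Z 1, Z n)" and "n \<ge> 1"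
    and f: "\<And>i. i \<in> {1..n-1} \<Longrightarrow> f i differentiable (at (V i, V (i+1)))"
    and g: "g differentiable (at (V 1, V n))"
    and hom: "\<And>c. F (\<lambda>i. c *\<^sub>R V i) = c ^ d * F V"
  shows "(\<Sum>j=1..n. V j \<bullet> node_grad F V j) = d * F V"
proof -
  have "((\<lambda>s. F (\<lambda>i. s *\<^sub>R V i)) has_real_derivative
          (\<Sum>j=1..n. V j \<bullet> node_grad F (\<lambda>i. 1 *\<^sub>R V i) j)) (at 1)"
    by (rule nodal_chain_rule[where f = f and g = g])
      (use F f g \<open>n \<ge> 1\<close> in
       \<open>auto simp: has_vector_derivative_def intro!: derivative_eq_intros\<close>)
  moreover have "((\<lambda>s. s ^ d * F V) has_real_derivative d * F V) (at 1)"
    by (auto intro!: derivative_eq_intros)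
  ultimately show ?thesis
    unfolding hom by (auto dest: DERIV_unique)
qed

section \<open>Closed forms of the integrals over an edge\<close>

text \<open>The integrand is a quadratic polynomial in \<mu>. The closed form turns the dissipation
  into a sum of edge terms, as the nodal chain rule requires, and makes its sign accessible.\<close>

lemma segment_integral_norm_square:
  "segment_integral X i (\<lambda>\<mu>. (norm (discrete_velocity V i \<mu>))\<^sup>2) =
     norm (X (i+1) - X i) / 3 * (V i \<bullet> V i + V i \<bullet> V (i+1) + V (i+1) \<bullet> V (i+1))"
proof -
  define p q r L where "p = V i \<bullet> V i" and "q = V i \<bullet> V (i+1)" and "r = V (i+1) \<bullet> V (i+1)"
    and "L = norm (X (i+1) - X i)"
  \<comment> \<open>An antiderivative vanishing at 0; its value at 1 is
    \<open>(p + q + r) / 3 * L\<close>.\<close>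
  define G where "G \<mu> = (\<mu> * p + \<mu>\<^sup>2 * (q - p) + \<mu> ^ 3 / 3 * (p - 2 * q + r)) * L" for \<mu> :: real
  have "(norm (discrete_velocity V i \<mu>))\<^sup>2 = p + 2 * \<mu> * (q - p) + \<mu>\<^sup>2 * (p - 2 * q + r)" for \<mu>
    unfolding discrete_velocity_def power2_norm_eq_inner p_def q_def r_def
    by (simp add: inner_add_left inner_add_right inner_commute power2_eq_square algebra_simps)
  then have "((\<lambda>\<mu>. (norm (discrete_velocity V i \<mu>))\<^sup>2 * L) has_integral G 1 - G 0) {0..1}"
    unfolding G_def
    by (simp only:, intro fundamental_theorem_of_calculus)
      (auto simp: power2_eq_square field_simps
        simp flip: has_real_derivative_iff_has_vector_derivative intro!: derivative_eq_intros)
  then have "segment_integral X i (\<lambda>\<mu>. (norm (discrete_velocity V i \<mu>))\<^sup>2) = G 1 - G 0"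
    unfolding segment_integral_def L_def by (rule integral_unique)
  then show ?thesis
    by (simp add: G_def L_def p_def q_def r_def algebra_simps)
qed

text \<open>The integrand is affine in \<mu>, so its mean is the average of the two end values. The
  vector \<open>w\<close> will be the unit normal of the edge.\<close>

lemma segment_integral_linear:
  "segment_integral X i (\<lambda>\<mu>. discrete_velocity V i \<mu> \<bullet> w) =
     norm (X (i+1) - X i) / 2 * ((V i + V (i+1)) \<bullet> w)"
proof -
  define a b L where "a = V i \<bullet> w" and "b = V (i+1) \<bullet> w" and "L = norm (X (i+1) - X i)"
  define G where "G \<mu> = (\<mu> * a + \<mu>\<^sup>2 / 2 * (b - a)) * L" for \<mu> :: real
  have "discrete_velocity V i \<mu> \<bullet> w = a + \<mu> * (b - a)" for \<mu>
    by (simp add: discrete_velocity_def a_def b_def inner_add_left algebra_simps)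
  then have "((\<lambda>\<mu>. discrete_velocity V i \<mu> \<bullet> w * L) has_integral G 1 - G 0) {0..1}"
    unfolding G_def
    by (simp only:, intro fundamental_theorem_of_calculus)
      (auto simp: field_simps
        simp flip: has_real_derivative_iff_has_vector_derivative intro!: derivative_eq_intros)
  then have "segment_integral X i (\<lambda>\<mu>. discrete_velocity V i \<mu> \<bullet> w) = G 1 - G 0"
    unfolding segment_integral_def L_def by (rule integral_unique)
  then show ?thesis
    by (simp add: G_def L_def a_def b_def algebra_simps inner_add_left)
qed

section \<open>Positive definiteness of the dissipation\<close>

text \<open>The mixed term has no sign by itself; as a sum of squares the form is visibly positive
  definite.\<close>

lemma inner_trinomial_eq_squares:
  fixes a b :: "'a::real_inner"
  shows "a \<bullet> a + a \<bullet> b + b \<bullet> b = ((norm a)\<^sup>2 + (norm b)\<^sup>2 + (norm (a + b))\<^sup>2) / 2"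
  by (simp add: power2_norm_eq_inner inner_add_left inner_add_right inner_commute)

lemma discrete_dissipation_nonneg:
  assumes "\<xi>\<^sub>0 \<ge> 0" "\<xi>\<^sub>1 \<ge> 0"
  shows "discrete_dissipation n \<xi>\<^sub>0 \<xi>\<^sub>1 X V \<ge> 0"
  unfolding discrete_dissipation_def segment_integral_norm_square inner_trinomial_eq_squares
  using assms by (intro add_nonneg_nonneg mult_nonneg_nonneg sum_nonneg) auto

text \<open>All contributions are nonnegative, so a vanishing total makes every edge term vanish.
  Edges have positive length, hence both end velocities of each edge are zero, and the edges reach
  every node.\<close>

lemma discrete_dissipation_eq_0_iff:
  assumes "n \<ge> 2" "\<xi>\<^sub>0 > 0" "\<xi>\<^sub>1 \<ge> 0"
    and X: "\<And>i. i \<in> {1..n-1} \<Longrightarrow> X (i+1) \<noteq> X i"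
  shows "discrete_dissipation n \<xi>\<^sub>0 \<xi>\<^sub>1 X V = 0 \<longleftrightarrow> (\<forall>i\<in>{1..n}. V i = 0)"
proof
  let ?e = "\<lambda>i. norm (X (i+1) - X i) / 3 *
    (((norm (V i))\<^sup>2 + (norm (V (i+1)))\<^sup>2 + (norm (V i + V (i+1)))\<^sup>2) / 2)"
  assume "discrete_dissipation n \<xi>\<^sub>0 \<xi>\<^sub>1 X V = 0"
  moreover have nonneg: "(\<Sum>i=1..n-1. ?e i) \<ge> 0"
    by (intro sum_nonneg) auto
  moreover have "\<xi>\<^sub>1 / 2 * (V 1 $ 1)\<^sup>2 \<ge> 0" "\<xi>\<^sub>1 / 2 * (V n $ 1)\<^sup>2 \<ge> 0"
    using assms(3) by auto
  moreover have "\<xi>\<^sub>0 / 2 * (\<Sum>i=1..n-1. ?e i) \<ge> 0"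
    using nonneg assms(2) by (intro mult_nonneg_nonneg) auto
  ultimately have "\<xi>\<^sub>0 / 2 * (\<Sum>i=1..n-1. ?e i) = 0"
    unfolding discrete_dissipation_def segment_integral_norm_square inner_trinomial_eq_squares
    by linarith
  then have "(\<Sum>i=1..n-1. ?e i) = 0"
    using assms(2) by simp
  then have e: "?e i = 0" if "i \<in> {1..n-1}" for i
    using that by (subst (asm) sum_nonneg_eq_0_iff) auto
  have edge: "V i = 0 \<and> V (i+1) = 0" if i: "i \<in> {1..n-1}" for i
  proof -
    have "(norm (V i))\<^sup>2 + (norm (V (i+1)))\<^sup>2 + (norm (V i + V (i+1)))\<^sup>2 = 0"
      using e[OF i] X[OF i] by simp
    then have "(norm (V i))\<^sup>2 = 0 \<and> (norm (V (i+1)))\<^sup>2 = 0"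
      using zero_le_power2[of "norm (V i)"] zero_le_power2[of "norm (V (i+1))"]
        zero_le_power2[of "norm (V i + V (i+1))"] by linarith
    then show ?thesis by simp
  qed
  show "\<forall>i\<in>{1..n}. V i = 0"
  proof
    fix i assume "i \<in> {1..n}"
    \<comment> \<open>Node \<open>n\<close> starts no edge; it is reached as the far end of edge
      \<open>n-1\<close>, which exists because \<open>n \<ge> 2\<close>.\<close>
    then have "i \<in> {1..n-1} \<or> i = (n-1) + 1" "n-1 \<in> {1..n-1}" using assms(1) by auto
    then show "V i = 0" using edge by metis
  qed
next
  assume "\<forall>i\<in>{1..n}. V i = 0"
  then show "discrete_dissipation n \<xi>\<^sub>0 \<xi>\<^sub>1 X V = 0"
    unfolding discrete_dissipation_def segment_integral_norm_square
    using assms(1) by (auto intro!: sum.neutral)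
qed

section \<open>Euler identities and the chain rule for the energy\<close>

text \<open>At fixed positions the dissipation is homogeneous of degree 2 in the velocities. The
  friction at the two contact points forms the end term \<open>g\<close>.\<close>

lemma discrete_dissipation_euler:
  assumes "n \<ge> 1"
  shows "(\<Sum>j=1..n. V j \<bullet> node_grad (discrete_dissipation n \<xi>\<^sub>0 \<xi>\<^sub>1 X) V j)
    = 2 * discrete_dissipation n \<xi>\<^sub>0 \<xi>\<^sub>1 X V"
proof -
  have "(\<Sum>j=1..n. V j \<bullet> node_grad (discrete_dissipation n \<xi>\<^sub>0 \<xi>\<^sub>1 X) V j)
    = real 2 * discrete_dissipation n \<xi>\<^sub>0 \<xi>\<^sub>1 X V"
  proof (rule euler_homogeneous_nodal[OF _ assms,
        where f = "\<lambda>i z. \<xi>\<^sub>0 / 2 * (norm (X (i+1) - X i) / 3 *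
                (fst z \<bullet> fst z + fst z \<bullet> snd z + snd z \<bullet> snd z))"
          and g = "\<lambda>z. \<xi>\<^sub>1 / 2 * (fst z $ 1)\<^sup>2 + \<xi>\<^sub>1 / 2 * (snd z $ 1)\<^sup>2"])
    show "discrete_dissipation n \<xi>\<^sub>0 \<xi>\<^sub>1 X (\<lambda>i. c *\<^sub>R V i) = c\<^sup>2 * discrete_dissipation n \<xi>\<^sub>0 \<xi>\<^sub>1 X V" for c
      unfolding discrete_dissipation_def segment_integral_norm_square
      by (simp add: sum_distrib_left power2_eq_square algebra_simps)
  qed (auto simp: discrete_dissipation_def segment_integral_norm_square sum_distrib_left
      differentiable_def
      intro!: exI derivative_eq_intros bounded_linear.has_derivative[OF bounded_linear_vec_nth])
  then show ?thesis by simp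
qed

text \<open>At fixed positions the area rate is homogeneous of degree 1 in the velocities and
  consists of edge terms only.\<close>

lemma area_rate_euler:
  assumes "n \<ge> 1"
  shows "(\<Sum>j=1..n. V j \<bullet> node_grad (area_rate n X) V j) = area_rate n X V"
proof -
  have "(\<Sum>j=1..n. V j \<bullet> node_grad (area_rate n X) V j) = real 1 * area_rate n X V"
  proof (rule euler_homogeneous_nodal[OF _ assms,
        where f = "\<lambda>i z. norm (X (i+1) - X i) / 2 * ((fst z + snd z) \<bullet> unit_normal X i)"
          and g = "\<lambda>z. 0"])
    show "area_rate n X (\<lambda>i. c *\<^sub>R V i) = c ^ 1 * area_rate n X V" for c
      unfolding area_rate_def segment_integral_linear
      by (simp add: sum_distrib_left inner_add_left algebra_simps)
  qed (auto simp: area_rate_def segment_integral_linear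
      differentiable_def intro!: exI derivative_eq_intros)
  then show ?thesis by simp
qed

text \<open>Here the positions vary. The Euclidean norm is differentiable away from the origin,
  which is where nondegenerate edges enter; the wetting term and the constant go into the end term
  \<open>g\<close>.\<close>

lemma discrete_energy_chain_rule:
  assumes "n \<ge> 1"
    and x: "\<And>i. i \<in> {1..n} \<Longrightarrow> (x i has_vector_derivative v i) (at t within T)"
    and edges: "\<And>i. i \<in> {1..n-1} \<Longrightarrow> x (i+1) t \<noteq> x i t"
  shows "((\<lambda>s. discrete_energy n \<gamma> \<theta>\<^sub>Y C (\<lambda>i. x i s)) has_real_derivative
    (\<Sum>j=1..n. v j \<bullet> node_grad (discrete_energy n \<gamma> \<theta>\<^sub>Y C) (\<lambda>i. x i t) j)) (at t within T)"
proof (rule nodal_chain_rule[OF _ assms(1) _ _ x,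
      where f = "\<lambda>i z. \<gamma> * norm (snd z - fst z)"
        and g = "\<lambda>z. C - \<gamma> * (fst z $ 1 - snd z $ 1) * cos \<theta>\<^sub>Y"])
  fix i assume "i \<in> {1..n-1}"
  then have "(norm has_derivative (\<lambda>h. h \<bullet> sgn (x (i+1) t - x i t))) (at (x (i+1) t - x i t))"
    using edges by (intro has_derivative_norm) auto
  then have "((\<lambda>z. norm (snd z - fst z)) has_derivative
      (\<lambda>h. (snd h - fst h) \<bullet> sgn (x (i+1) t - x i t))) (at (x i t, x (i+1) t))"
    by (intro has_derivative_compose[where g = norm and f = "\<lambda>z. snd z - fst z"])
      (auto intro!: derivative_eq_intros)
  then show "(\<lambda>z. \<gamma> * norm (snd z - fst z)) differentiable (at (x i t, x (i+1) t))"
    by (auto simp: differentiable_def intro: has_derivative_mult_right)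
qed (auto simp: discrete_energy_def sum_distrib_left differentiable_def algebra_simps
    intro!: exI derivative_eq_intros bounded_linear.has_derivative[OF bounded_linear_vec_nth])

section \<open>The energy law\<close>

theorem theorem5p1:
  fixes n :: nat and \<gamma> \<xi>\<^sub>0 \<xi>\<^sub>1 \<theta>\<^sub>Y C :: real
    and T :: "real set"
    and x v :: "nat \<Rightarrow> real \<Rightarrow> real^2"
    and lam :: "real \<Rightarrow> real"
  assumes "n \<ge> 3" and "\<gamma> > 0" and "\<xi>\<^sub>0 > 0" and "\<xi>\<^sub>1 > 0"
    and "is_interval T" and "interior T \<noteq> {}"
    and "\<And>i t. i \<in> {1..n} \<Longrightarrow> t \<in> T \<Longrightarrow> (x i has_vector_derivative v i t) (at t within T)"
    and "\<And>t. t \<in> T \<Longrightarrow> x 1 t $ 2 = 0 \<and> x n t $ 2 = 0"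
    and "\<And>t. t \<in> T \<Longrightarrow> x n t $ 1 < x 1 t $ 1"
    and "\<And>i t. i \<in> {1..n-1} \<Longrightarrow> t \<in> T \<Longrightarrow> x (i+1) t \<noteq> x i t"
    and "\<And>t. t \<in> T \<Longrightarrow>
           wetting_system n \<gamma> \<xi>\<^sub>0 \<xi>\<^sub>1 \<theta>\<^sub>Y C (\<lambda>i. x i t) (\<lambda>i. v i t) (lam t)"
  shows "\<forall>t\<in>T.
    ((\<lambda>s. discrete_energy n \<gamma> \<theta>\<^sub>Y C (\<lambda>i. x i s)) has_real_derivative
        - 2 * discrete_dissipation n \<xi>\<^sub>0 \<xi>\<^sub>1 (\<lambda>i. x i t) (\<lambda>i. v i t)) (at t within T) \<and>
    - 2 * discrete_dissipation n \<xi>\<^sub>0 \<xi>\<^sub>1 (\<lambda>i. x i t) (\<lambda>i. v i t) \<le> 0 \<and>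
    (((\<lambda>s. discrete_energy n \<gamma> \<theta>\<^sub>Y C (\<lambda>i. x i s)) has_real_derivative 0) (at t within T)
        \<longleftrightarrow> (\<forall>i\<in>{1..n}. v i t = 0))"
proof
  fix t assume t: "t \<in> T"
  let ?X = "\<lambda>i. x i t" and ?V = "\<lambda>i. v i t"
  let ?\<Phi> = "discrete_dissipation n \<xi>\<^sub>0 \<xi>\<^sub>1 ?X" and ?S = "area_rate n ?X"
    and ?E = "discrete_energy n \<gamma> \<theta>\<^sub>Y C"
  have sys: "wetting_system n \<gamma> \<xi>\<^sub>0 \<xi>\<^sub>1 \<theta>\<^sub>Y C ?X ?V (lam t)"
    using assms(11) t by simp
  have balance: "?V j \<bullet> node_grad ?E ?X j =
      - (?V j \<bullet> node_grad ?\<Phi> ?V j + lam t * (?V j \<bullet> node_grad ?S ?V j))" if "j \<in> {1..n}" for j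
  proof (cases "j \<in> {2..n-1}")
    case True
    then have "node_grad ?E ?X j = - (node_grad ?\<Phi> ?V j + lam t *\<^sub>R node_grad ?S ?V j)"
      using sys unfolding wetting_system_def by (metis add.inverse_inverse)
    then show ?thesis by (simp add: inner_diff_right)
  next
    case False
    then have j: "j \<in> {1, n}" using that by auto
    then have "node_partial ?E ?X j 1 = - (node_partial ?\<Phi> ?V j 1 + lam t * node_partial ?S ?V j 1)"
      using sys unfolding wetting_system_def by (metis add.inverse_inverse)
    moreover have "?V j $ 2 = 0"
      using sys j unfolding wetting_system_def by auto
    ultimately show ?thesis
      by (simp add: inner_vec_def UNIV_2 node_grad_def right_diff_distrib)
  qed
  have "(\<Sum>j=1..n. ?V j \<bullet> node_grad ?E ?X j) =
      - ((\<Sum>j=1..n. ?V j \<bullet> node_grad ?\<Phi> ?V j) + lam t * (\<Sum>j=1..n. ?V j \<bullet> node_grad ?S ?V j))"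
    by (simp add: balance sum.distrib sum_distrib_left sum_negf sum_subtractf)
  also have "\<dots> = - 2 * ?\<Phi> ?V"
    using sys discrete_dissipation_euler[of n ?V \<xi>\<^sub>0 \<xi>\<^sub>1 ?X] area_rate_euler[of n ?V ?X] \<open>n \<ge> 3\<close>
    unfolding wetting_system_def by simp
  finally have deriv: "((\<lambda>s. ?E (\<lambda>i. x i s)) has_real_derivative - 2 * ?\<Phi> ?V) (at t within T)"
    using discrete_energy_chain_rule[of n x ?V t T \<gamma> \<theta>\<^sub>Y C] assms(1,7,10) t by simp
  \<comment> \<open>A derivative within \<open>T\<close> is unique only at limit points of
    \<open>T\<close>. An interval with nonempty interior is connected and no singleton, so each of
    its points, boundary points included, is a limit point.\<close>
  have "t islimpt T"
  proof (rule connected_imp_perfect)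
    show "connected T" using assms(5) by (rule is_interval_connected)
    show "T \<noteq> {a}" for a using assms(6) by auto
  qed fact
  then have "at t within T \<noteq> bot"
    by (simp add: trivial_limit_within)
  \<comment> \<open>By uniqueness a zero derivative must coincide with
    \<open>- 2 * ?\<Phi> ?V\<close>, so the equality case reduces to vanishing dissipation.\<close>
  then have unique: "(((\<lambda>s. ?E (\<lambda>i. x i s)) has_real_derivative 0) (at t within T)) \<longleftrightarrow> ?\<Phi> ?V = 0"
    using deriv vector_derivative_unique_within[of t T _ "- 2 * ?\<Phi> ?V" 0]
    unfolding has_real_derivative_iff_has_vector_derivative by auto
  show "((\<lambda>s. ?E (\<lambda>i. x i s)) has_real_derivative - 2 * ?\<Phi> ?V) (at t within T) \<and>
    - 2 * ?\<Phi> ?V \<le> 0 \<and>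
    (((\<lambda>s. ?E (\<lambda>i. x i s)) has_real_derivative 0) (at t within T) \<longleftrightarrow> (\<forall>i\<in>{1..n}. v i t = 0))"
    using deriv unique discrete_dissipation_nonneg[of \<xi>\<^sub>0 \<xi>\<^sub>1 n ?X ?V]
      discrete_dissipation_eq_0_iff[of n \<xi>\<^sub>0 \<xi>\<^sub>1 ?X ?V] assms(1,3,4,10) t
    by simp
qed

end
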